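(* Let $G$ be a connected graph with at least one cycle and let $\mathrm{g}(G)$ be the girth of $G$. Then the following hold: (i) $\sigma^{\boxtimes}_V(G) \geq \left\lfloor \frac{\mathrm{g}(G)}{2} \right\rfloor$; (ii) $\sigma^{\Box}_V(G) \geq \left\lfloor \frac{\mathrm{g}(G)}{2} \right\rfloor - 1$; and (iii) $\sigma^{\times}_V(G) \geq \left\lfloor \frac{\mathrm{g}(G)}{2} \right\rfloor - 1$.
   Context: All graphs are finite, simple and non-empty; $d_H$ denotes the shortest-path distance in $H$. The girth of a graph is the length of a shortest cycle. A function $f: V(P)\to V(H)$ is a weak homomorphism $f:P\to H$ if for every edge $uv\in E(P)$ either $f(u)f(v)\in E(H)$ or $f(u)=f(v)$. It is surjective if $f(V(P))=V(H)$. For weak homomorphisms $f,g:P\to H$ put $m_P(f,g)=\min\{d_H(f(u),g(u)) \mid u\in V(P)\}$. Two weak homomorphisms $f,g:P\to H$ are aligned if for every $uv\in E(P)$: $f(u)f(v)\in E(H) \Leftrightarrow g(u)g(v)\in E(H)$. They are opposite if for every $uv\in E(P)$: $f(u)f(v)\in E(H)\Leftrightarrow g(u)=g(v)$. For a connected graph $H$, each span below is the maximum of $m_P(f,g)$ over all (finite) paths $P$ and all pairs $f,g:P\to H$ of weak homomorphisms of the indicated kind: - strong vertex span $\sigma^{\boxtimes}_V(H)$: $f,g$ surjective; - direct vertex span $\sigma^{\times}_V(H)$: $f,g$ surjective and aligned; - Cartesian vertex span $\sigma^{\Box}_V(H)$: $f,g$ surjective and opposite. *)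

theory Defs
  imports "Graph_Theory.Graph_Theory"
begin

text \<open>
  Finite simple graphs are symmetric loop-free pair digraphs (\<open>pair_graph\<close>): an undirected edge
  \<open>uv\<close> is the pair of arcs \<open>(u,v)\<close>, \<open>(v,u)\<close>. The predicate \<open>connected\<close> of the library entails that
  the vertex set is non-empty.
\<close>

text \<open>In a symmetric digraph the library's \<open>cycle\<close> admits \<open>u, v, u\<close>, hence the length bound.\<close>

definition graph_cycle :: "'a pair_pre_digraph \<Rightarrow> ('a \<times> 'a) awalk \<Rightarrow> bool" where
  "graph_cycle G c \<longleftrightarrow> pre_digraph.cycle (with_proj G) c \<and> 3 \<le> length c"

text \<open>Only meaningful for graphs that contain a cycle (the infimum of the empty set is 0).\<close>

definition girth :: "'a pair_pre_digraph \<Rightarrow> nat" where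
  "girth G = Inf {length c | c. graph_cycle G c}"

text \<open>
  Only meaningful for vertices joined by a path (the infimum of the empty set is 0). It is the
  natural-number version of the library's \<open>\<mu>\<close> for unit weights, see \<open>graph_dist_eq_mu\<close>.
\<close>

definition graph_dist :: "'a pair_pre_digraph \<Rightarrow> 'a \<Rightarrow> 'a \<Rightarrow> nat" where
  "graph_dist H u v = Inf {length p | p. pre_digraph.apath (with_proj H) u p v}"

lemma graph_dist_eq_mu:
  fixes H :: "'a pair_pre_digraph"
  assumes "wf_digraph (with_proj H)" and "u \<rightarrow>\<^sup>*\<^bsub>with_proj H\<^esub> v"
  shows "wf_digraph.\<mu> (with_proj H) (\<lambda>_. 1) u v = ereal (real (graph_dist H u v))"
proof -
  interpret wf_digraph "with_proj H" by fact
  have cost: "awalk_cost (\<lambda>_. 1) p = real (length p)" for p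
    by (induction p) auto
  let ?S = "{length p | p. apath u p v}"
  have "?S \<noteq> {}" using assms(2) by (auto simp: reachable_apath)
  then have "Inf ?S \<in> ?S" by (rule Inf_nat_def1)
  then obtain p where p: "apath u p v" "length p = graph_dist H u v"
    by (auto simp: graph_dist_def)
  have le: "graph_dist H u v \<le> length q" if "awalk u q v" for q
    using that
  proof (induct rule: awalk_to_apath_induct)
    case (path q)
    then show ?case
      unfolding graph_dist_def by (intro cInf_lower) (auto simp: apath_def)
  next
    case (decomp p q r s)
    from decomp(2,1,3) have "p = q @ r @ s" by (rule awalk_cyc_decompE)
    with decomp(4) show ?case by simp
  qed
  show ?thesis unfolding \<mu>_def cost
  proof (rule antisym)
    show "(INF q\<in>{q. awalk u q v}. ereal (real (length q))) \<le> ereal (real (graph_dist H u v))"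
      using p by (intro INF_lower2[of p]) (auto simp: apath_def)
    show "ereal (real (graph_dist H u v)) \<le> (INF q\<in>{q. awalk u q v}. ereal (real (length q)))"
      using le by (intro INF_greatest) auto
  qed
qed

text \<open>A path as a graph, i.e. some \<open>P\<^sub>n\<close> with \<open>n \<ge> 1\<close> vertices; a single vertex is a path.\<close>

definition path_graph :: "'p pair_pre_digraph \<Rightarrow> bool" where
  "path_graph P \<longleftrightarrow> (\<exists>xs. xs \<noteq> [] \<and> distinct xs \<and> pverts P = set xs \<and>
     parcs P = set (vwalk_arcs xs) \<union> (set (vwalk_arcs xs))\<inverse>)"

definition weak_hom :: "'p pair_pre_digraph \<Rightarrow> 'a pair_pre_digraph \<Rightarrow> ('p \<Rightarrow> 'a) \<Rightarrow> bool" where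
  "weak_hom P H f \<longleftrightarrow> f ` pverts P \<subseteq> pverts H \<and>
     (\<forall>(u, v) \<in> parcs P. (f u, f v) \<in> parcs H \<or> f u = f v)"

definition surj_weak_hom :: "'p pair_pre_digraph \<Rightarrow> 'a pair_pre_digraph \<Rightarrow> ('p \<Rightarrow> 'a) \<Rightarrow> bool" where
  "surj_weak_hom P H f \<longleftrightarrow> weak_hom P H f \<and> f ` pverts P = pverts H"

definition aligned ::
    "'p pair_pre_digraph \<Rightarrow> 'a pair_pre_digraph \<Rightarrow> ('p \<Rightarrow> 'a) \<Rightarrow> ('p \<Rightarrow> 'a) \<Rightarrow> bool" where
  "aligned P H f g \<longleftrightarrow> (\<forall>(u, v) \<in> parcs P. (f u, f v) \<in> parcs H \<longleftrightarrow> (g u, g v) \<in> parcs H)"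

definition opposite ::
    "'p pair_pre_digraph \<Rightarrow> 'a pair_pre_digraph \<Rightarrow> ('p \<Rightarrow> 'a) \<Rightarrow> ('p \<Rightarrow> 'a) \<Rightarrow> bool" where
  "opposite P H f g \<longleftrightarrow> (\<forall>(u, v) \<in> parcs P. (f u, f v) \<in> parcs H \<longleftrightarrow> g u = g v)"

definition min_dist ::
    "'p pair_pre_digraph \<Rightarrow> 'a pair_pre_digraph \<Rightarrow> ('p \<Rightarrow> 'a) \<Rightarrow> ('p \<Rightarrow> 'a) \<Rightarrow> nat" where
  "min_dist P H f g = Min {graph_dist H (f u) (g u) | u. u \<in> pverts P}"

text \<open>
  The spans range over all paths on natural-number vertices; every finite path is isomorphic to
  such a path.
\<close>

definition strong_vertex_span :: "'a pair_pre_digraph \<Rightarrow> nat" where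
  "strong_vertex_span H = Max {min_dist P H f g | (P :: nat pair_pre_digraph) f g.
     path_graph P \<and> surj_weak_hom P H f \<and> surj_weak_hom P H g}"

definition direct_vertex_span :: "'a pair_pre_digraph \<Rightarrow> nat" where
  "direct_vertex_span H = Max {min_dist P H f g | (P :: nat pair_pre_digraph) f g.
     path_graph P \<and> surj_weak_hom P H f \<and> surj_weak_hom P H g \<and> aligned P H f g}"

definition cartesian_vertex_span :: "'a pair_pre_digraph \<Rightarrow> nat" where
  "cartesian_vertex_span H = Max {min_dist P H f g | (P :: nat pair_pre_digraph) f g.
     path_graph P \<and> surj_weak_hom P H f \<and> surj_weak_hom P H g \<and> opposite P H f g}"

end

theory Submission
  imports Defs
begin

text \<open>
  Let \<open>k\<close> be half the girth, rounded down. If \<open>d(a, b) < k\<close>, then all neighbours of \<open>b\<close> but one are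
  farther from \<open>a\<close> than \<open>b\<close> is, since otherwise there would be a closed walk of length less than the
  girth containing a cycle. Hence a walker who stays on a fixed cycle, where each vertex has two
  neighbours, can keep away from a walker who moves through the graph arbitrarily: after the latter's
  move, he steps away if necessary. This keeps the distance at least \<open>k\<close>; it is at least \<open>k - 1\<close> in
  between if the two move in turn, and also if both have to move in every step. When the
  first walker has visited all vertices, the two exchange their roles.
\<close>

section \<open>Distance and girth\<close>

lemma girth_le: "graph_cycle G c \<Longrightarrow> girth G \<le> length c"
  unfolding girth_def by (rule cInf_lower) auto

lemma length_rev_path: "length (rev_path p) = length p"
  by (induction p) auto

lemma set_rev_path: "set (rev_path p) = prod.swap ` set p"
  by (induction p) (auto simp: prod.swap_def)

text \<open>The path repeats no arc and all its arcs occur in \<open>p\<close>, so comparing the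
  numbers of distinct arcs suffices.\<close>

lemma (in wf_digraph) length_awalk_to_apath:
  assumes "awalk u p v"
  shows "length (awalk_to_apath p) \<le> length p"
proof -
  have "apath u (awalk_to_apath p) v"
    using assms by (rule apath_awalk_to_apath)
  then have "distinct (awalk_to_apath p)"
    unfolding apath_def by (blast intro: distinct_verts_imp_distinct)
  then have "length (awalk_to_apath p) = card (set (awalk_to_apath p))"
    by (simp add: distinct_card)
  also have "\<dots> \<le> card (set p)"
    using awalk_to_apath_subset[OF assms] by (simp add: card_mono)
  finally show ?thesis
    using card_length[of p] by linarith
qed

context pair_graph
begin

lemma graph_dist_le_awalk:
  assumes "awalk u p v"
  shows "graph_dist G u v \<le> length p"
proof -
  have "graph_dist G u v \<le> length (awalk_to_apath p)"
    unfolding graph_dist_def using apath_awalk_to_apath[OF assms]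
    by (intro cInf_lower) auto
  then show ?thesis
    using length_awalk_to_apath[OF assms] by linarith
qed

lemma shortest_apath:
  assumes "connected (with_proj G)" "u \<in> pverts G" "v \<in> pverts G"
  obtains p where "apath u p v" "length p = graph_dist G u v"
proof -
  have "u \<rightarrow>\<^sup>*\<^bsub>with_proj G\<^esub> v"
    using symmetric_connected_imp_strongly_connected[OF pair_sym_arcs assms(1)] assms(2,3)
    by (auto elim: strongly_connectedE)
  then have "{length p | p. apath u p v} \<noteq> {}"
    by (auto simp: reachable_apath)
  then have "Inf {length p | p. apath u p v} \<in> {length p | p. apath u p v}"
    by (rule Inf_nat_def1)
  then show ?thesis
    using that by (auto simp: graph_dist_def)
qed

lemma graph_dist_commute: "graph_dist G u v = graph_dist G v u"
proof -
  have "{length p | p. apath u p v} \<subseteq> {length p | p. apath v p u}" for u v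
  proof
    fix n assume "n \<in> {length p | p. apath u p v}"
    then obtain p where "apath u p v" "n = length p" by blast
    then have "apath v (rev_path p) u" "n = length (rev_path p)"
      by (simp_all add: length_rev_path)
    then show "n \<in> {length p | p. apath v p u}" by blast
  qed
  then have "{length p | p. apath u p v} = {length p | p. apath v p u}"
    by blast
  then show ?thesis
    by (simp add: graph_dist_def)
qed

lemma graph_dist_step:
  assumes "connected (with_proj G)" "(a, a') \<in> parcs G" "b \<in> pverts G"
  shows "graph_dist G a b \<le> Suc (graph_dist G a' b)"
proof -
  have "a' \<in> pverts G" using assms(2) by (rule in_arcsD2)
  then obtain p where p: "apath a' p b" "length p = graph_dist G a' b"
    using assms(1,3) by (blast elim: shortest_apath)
  have "awalk a ((a, a') # p) b"
    using p(1) assms(2) by (simp add: awalk_Cons_iff apath_def)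
  then show ?thesis
    using graph_dist_le_awalk[of a "(a, a') # p" b] p(2) by simp
qed

text \<open>Shortening \<open>p\<close> to a path introduces no new arcs, so the path still avoids
  \<open>(y, x)\<close>. Hence it is not just the edge traversed backwards, and closing it with
  \<open>(x, y)\<close> gives a genuine cycle instead of the degenerate
  \<open>x, y, x\<close>.\<close>

lemma girth_le_closing_arc:
  assumes "(x, y) \<in> parcs G" "awalk y p x" "(y, x) \<notin> set p"
  shows "girth G \<le> Suc (length p)"
proof -
  let ?q = "awalk_to_apath p"
  have q: "apath y ?q x" using assms(2) by (rule apath_awalk_to_apath)
  have "(y, x) \<notin> set ?q" using awalk_to_apath_subset[OF assms(2)] assms(3) by blast
  moreover have "x \<noteq> y" using assms(1) by (rule no_loops')
  ultimately have "2 \<le> length ?q"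
    using q by (cases ?q rule: list_exhaust_NSC) (auto simp: apath_simps)
  moreover have "cycle ((x, y) # ?q)"
    unfolding cycle_def using q assms(1)
    by (intro exI[of _ x]) (auto simp: awalk_Cons_iff apath_def)
  ultimately have "graph_cycle G ((x, y) # ?q)"
    by (simp add: graph_cycle_def)
  then show ?thesis
    using girth_le length_awalk_to_apath[OF assms(2)] by fastforce
qed

text \<open>A shortest path to \<open>x\<close> that is not longer than the shortest path \<open>p\<close> to \<open>b\<close> would close up
  with \<open>p\<close> and the edge \<open>bx\<close> to a cycle shorter than the girth.\<close>

lemma neighbour_farther:
  assumes conn: "connected (with_proj G)"
    and bx: "(b, x) \<in> parcs G"
    and p: "apath a p b" "length p = graph_dist G a b" "(x, b) \<notin> set p"
    and close: "graph_dist G a b < girth G div 2"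
  shows "graph_dist G a b < graph_dist G a x"
proof (rule ccontr)
  assume "\<not> ?thesis"
  then have le: "graph_dist G a x \<le> graph_dist G a b" by simp
  have "a \<in> pverts G" using p(1) by (auto simp: apath_def)
  moreover have "x \<in> pverts G" using bx by (rule in_arcsD2)
  ultimately obtain q where q: "apath a q x" "length q = graph_dist G a x"
    using conn by (blast elim: shortest_apath)
  \<comment> \<open>Otherwise the part of \<open>q\<close> before this arc would reach
    \<open>b\<close> in fewer steps than the distance from \<open>a\<close> to
    \<open>b\<close>.\<close>
  have "(b, x) \<notin> set q"
  proof
    assume "(b, x) \<in> set q"
    then obtain r s where rs: "q = r @ (b, x) # s" by (auto simp: in_set_conv_decomp)
    then have "awalk a r b"
      using q(1) by (auto simp: apath_def awalk_Cons_iff)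
    then have "graph_dist G a b \<le> length r" by (rule graph_dist_le_awalk)
    with rs q(2) le show False by simp
  qed
  then have "(x, b) \<notin> set (rev_path q @ p)"
    using p(3) by (auto simp: set_rev_path)
  moreover have "awalk x (rev_path q @ p) b"
    using p(1) q(1) by (intro awalk_appendI[of x _ a]) (auto simp: apath_def)
  ultimately have "girth G \<le> Suc (length (rev_path q @ p))"
    using bx by (intro girth_le_closing_arc)
  \<comment> \<open>With \<open>d\<close> the distance from \<open>a\<close> to \<open>b\<close>,
    the closed walk has at most \<open>2 * d + 1\<close> arcs, whereas \<open>close\<close> gives
    \<open>2 * d + 2 \<le> girth G\<close>.\<close>
  with le p(2) q(2) close show False by (simp add: length_rev_path)
qed

text \<open>A shortest path from \<open>a\<close> enters \<open>b\<close> from only one neighbour;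
  whichever of \<open>x\<close> and \<open>y\<close> is not that neighbour satisfies the hypotheses
  of \<open>neighbour_farther\<close>.\<close>

lemma one_of_two_neighbours_farther:
  assumes conn: "connected (with_proj G)"
    and a: "a \<in> pverts G"
    and nb: "(b, x) \<in> parcs G" "(b, y) \<in> parcs G" "x \<noteq> y"
    and close: "graph_dist G a b < girth G div 2"
  shows "graph_dist G a b < graph_dist G a x \<or> graph_dist G a b < graph_dist G a y"
proof -
  have "b \<in> pverts G" using nb(1) by (rule in_arcsD1)
  with conn a obtain p where p: "apath a p b" "length p = graph_dist G a b"
    by (blast elim: shortest_apath)
  \<comment> \<open>A path meets its end vertex only once, so an arc into \<open>b\<close> can only
    be the last one.\<close>
  have last: "z = fst (last p)" if zb: "(z, b) \<in> set p" for z
  proof -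
    obtain r s where rs: "p = r @ (z, b) # s" using split_list[OF zb] by blast
    then have "apath b s b" using p(1) by (auto simp: apath_append_iff apath_Cons_iff)
    then have "s = []" using apath_nonempty_ends by blast
    with rs show ?thesis by simp
  qed
  then have "(x, b) \<notin> set p \<or> (y, b) \<notin> set p" using nb(3) by metis
  then show ?thesis
    using neighbour_farther[OF conn _ p _ close] nb(1,2) by blast
qed

text \<open>The two neighbours are the successor and the predecessor of \<open>b\<close> on the
  cycle. As a cycle is closed, the heads of its arcs are all its vertices.\<close>

lemma cycle_two_neighbours:
  assumes c: "graph_cycle G c" and b: "b \<in> snd ` set c"
  obtains x y where "x \<in> snd ` set c" "y \<in> snd ` set c" "x \<noteq> y"
    "(b, x) \<in> parcs G" "(b, y) \<in> parcs G"
proof -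
  obtain u where u: "awalk u c u" "distinct (tl (awalk_verts u c))" "c \<noteq> []" "3 \<le> length c"
    using c by (auto simp: graph_cycle_def cycle_def)
  then have dist: "distinct (map snd c)"
    by (subst (asm) awalk_verts_conv'[of u c u]) auto
  obtain e p q where e: "b = snd e" "c = p @ e # q"
    using b by (auto simp: in_set_conv_decomp)
  have "awalk u p (fst e)" "awalk b q u" "e \<in> parcs G"
    using u(1) e by (auto simp: awalk_Cons_iff)
  \<comment> \<open>Rotating the cycle to start at \<open>b\<close> and dropping the arc
    \<open>e\<close> into \<open>b\<close> leaves a walk from the successor arc \<open>d\<close> to
    the predecessor \<open>fst e\<close>.\<close>
  then have w: "awalk b (q @ p) (fst e)" by (blast intro: awalk_appendI)
  have len: "2 \<le> length (q @ p)" using u(4) e(2) by simp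
  then obtain d r where r: "q @ p = d # r" "r \<noteq> []"
    by (cases "q @ p" rule: list_exhaust_NSC) auto
  have d: "fst d = b" "d \<in> parcs G" "awalk (snd d) r (fst e)"
    using w unfolding r(1) by (auto simp: awalk_Cons_iff)
  have "fst e = snd (last r)"
    using d(3) r(2) by (auto simp: awalk_verts_conv)
  \<comment> \<open>The heads are distinct, and by the length bound at least two arcs remain, so the
    first head \<open>snd d\<close> is not the last one, \<open>fst e\<close>.\<close>
  moreover have "distinct (map snd (q @ p))" using dist e(2) by auto
  then have "snd d \<notin> snd ` set r" unfolding r(1) by simp
  ultimately have "snd d \<noteq> fst e" using r(2) by auto
  moreover have "set (q @ p) \<subseteq> set c" using e(2) by auto
  then have "d \<in> set c" "last r \<in> set c" using r by auto
  moreover have "(b, snd d) \<in> parcs G" using d(1,2) by (metis prod.collapse)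
  moreover have "(b, fst e) \<in> parcs G"
    using \<open>e \<in> parcs G\<close> e(1) arcs_symmetric[of "fst e" "snd e"] by simp
  ultimately show ?thesis
    using that[of "snd d" "fst e"] \<open>fst e = snd (last r)\<close> by auto
qed

end

section \<open>Walks of pairs and spans\<close>

lemma successively_extend:
  assumes "R\<^sup>*\<^sup>* s t" "xs \<noteq> []" "successively R xs" "last xs = s"
  shows "\<exists>ys. ys \<noteq> [] \<and> successively R ys \<and> last ys = t \<and> hd ys = hd xs \<and> set xs \<subseteq> set ys"
  using assms(1)
proof induction
  case base
  then show ?case using assms by blast
next
  case (step y z)
  then obtain ys where ys: "ys \<noteq> []" "successively R ys" "last ys = y" "hd ys = hd xs"
    "set xs \<subseteq> set ys" by blast
  then have "successively R (ys @ [z])"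
    using step.hyps(2) by (simp add: successively_append_iff)
  with ys show ?case by (intro exI[of _ "ys @ [z]"]) auto
qed

text \<open>The elements are added one at a time: symmetry allows returning from the end of the tour
  built so far to \<open>s\<close>, from where the next element is reachable.\<close>

lemma symp_rtranclp_tour:
  assumes "finite X" "symp R" "\<And>x. x \<in> X \<Longrightarrow> R\<^sup>*\<^sup>* s x"
  shows "\<exists>xs. xs \<noteq> [] \<and> hd xs = s \<and> successively R xs \<and> R\<^sup>*\<^sup>* s (last xs) \<and> X \<subseteq> set xs"
  using assms(1,3)
proof (induction X rule: finite_induct)
  case empty
  show ?case by (intro exI[of _ "[s]"]) simp
next
  case (insert x X)
  then obtain xs where xs: "xs \<noteq> []" "hd xs = s" "successively R xs" "R\<^sup>*\<^sup>* s (last xs)" "X \<subseteq> set xs"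
    by blast
  have "R\<^sup>*\<^sup>* (last xs) s"
    using xs(4) sympD[OF symp_rtranclp[OF assms(2)]] by blast
  also have "R\<^sup>*\<^sup>* s x" using insert.prems by blast
  finally obtain ys where ys: "ys \<noteq> []" "successively R ys" "last ys = x" "hd ys = s" "set xs \<subseteq> set ys"
    using successively_extend[of R "last xs" x xs] xs by blast
  then have "x \<in> set ys" by auto
  with ys xs(5) \<open>R\<^sup>*\<^sup>* s x\<close> show ?case by blast
qed

section \<open>From walks of pairs to weak homomorphisms on paths\<close>

lemma set_vwalk_arcs_upt: "set (vwalk_arcs [0..<n]) = {(i, Suc i) | i. Suc i < n}"
proof (induction n)
  case (Suc n)
  show ?case
  proof (cases n)
    case (Suc k)
    then have "set (vwalk_arcs [0..<Suc n]) = insert (k, n) (set (vwalk_arcs [0..<n]))"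
      using set_vwalk_arcs_snoc[of "[0..<n]" n] by simp
    with Suc.IH Suc show ?thesis by auto
  qed simp
qed simp

text \<open>\<open>K\<close> tells which combinations of moving and resting are allowed: anything for the strong,
  equality for the direct and inequality for the Cartesian span.\<close>

definition pair_step ::
    "(bool \<Rightarrow> bool \<Rightarrow> bool) \<Rightarrow> nat \<Rightarrow> 'a pair_pre_digraph \<Rightarrow> 'a \<times> 'a \<Rightarrow> 'a \<times> 'a \<Rightarrow> bool" where
  "pair_step K m G = (\<lambda>(a, b) (a', b').
     {a, a', b, b'} \<subseteq> pverts G \<and>
     ((a, a') \<in> parcs G \<or> a = a') \<and> ((b, b') \<in> parcs G \<or> b = b') \<and>
     K ((a, a') \<in> parcs G) ((b, b') \<in> parcs G) \<and>
     m \<le> graph_dist G a b \<and> m \<le> graph_dist G a' b')"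

definition span_witness ::
    "(bool \<Rightarrow> bool \<Rightarrow> bool) \<Rightarrow> nat \<Rightarrow> 'a pair_pre_digraph \<Rightarrow>
     nat pair_pre_digraph \<Rightarrow> (nat \<Rightarrow> 'a) \<Rightarrow> (nat \<Rightarrow> 'a) \<Rightarrow> bool" where
  "span_witness K m G P f g \<longleftrightarrow> path_graph P \<and> surj_weak_hom P G f \<and> surj_weak_hom P G g \<and>
     m \<le> min_dist P G f g \<and>
     (\<forall>(u, v) \<in> parcs P. K ((f u, f v) \<in> parcs G) ((g u, g v) \<in> parcs G))"

lemma finite_pverts_path_graph: "path_graph P \<Longrightarrow> finite (pverts P) \<and> pverts P \<noteq> {}"
  by (auto simp: path_graph_def)

text \<open>There are infinitely many paths, but every value in the set is a distance between two
  vertices of \<open>G\<close>. So the set is finite and \<open>Max\<close> really bounds its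
  members.\<close>

lemma Max_min_dist_ge:
  assumes fin: "finite (pverts G)"
    and Q: "\<And>P f g. Q P f g \<Longrightarrow> path_graph P \<and> surj_weak_hom P G f \<and> surj_weak_hom P G g"
    and wit: "Q P f g" "m \<le> min_dist P G f g"
  shows "m \<le> Max {min_dist P G f g | (P :: nat pair_pre_digraph) f g. Q P f g}"
proof -
  have "{min_dist P G f g | (P :: nat pair_pre_digraph) f g. Q P f g}
    \<subseteq> (\<lambda>(u, v). graph_dist G u v) ` (pverts G \<times> pverts G)" (is "?S \<subseteq> ?T")
  proof
    fix n assume "n \<in> ?S"
    then obtain P f g where n: "n = min_dist P G f g" and "Q P f g" by blast
    then have P: "path_graph P" "surj_weak_hom P G f" "surj_weak_hom P G g"
      using Q by blast+
    let ?D = "{graph_dist G (f u) (g u) | u. u \<in> pverts P}"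
    have "?D = (\<lambda>u. graph_dist G (f u) (g u)) ` pverts P" by blast
    then have "finite ?D" "?D \<noteq> {}"
      using finite_pverts_path_graph[OF P(1)] by simp_all
    then have "n \<in> ?D" unfolding n min_dist_def by (rule Min_in)
    then show "n \<in> ?T"
      using P(2,3) by (auto simp: surj_weak_hom_def)
  qed
  then have "finite ?S" using fin finite_subset by blast
  moreover have "min_dist P G f g \<in> ?S" using wit(1) by blast
  ultimately show ?thesis using wit(2) Max_ge le_trans by blast
qed

context pair_graph
begin

lemma symp_pair_step:
  assumes "symp K"
  shows "symp (pair_step K m G)"
  using arcs_symmetric by (auto simp: pair_step_def symp_def)

lemma pair_step_swap:
  assumes "symp K" "pair_step K m G s t"
  shows "pair_step K m G (prod.swap s) (prod.swap t)"
proof -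
  obtain a b a' b' where st: "s = (a, b)" "t = (a', b')"
    by (cases s; cases t)
  show ?thesis
    using assms(2) sympD[OF assms(1)] unfolding st
    by (simp add: pair_step_def graph_dist_commute[of b a] graph_dist_commute[of b' a'])
qed

lemma pair_steps_swap:
  assumes "symp K" "(pair_step K m G)\<^sup>*\<^sup>* s t"
  shows "(pair_step K m G)\<^sup>*\<^sup>* (prod.swap s) (prod.swap t)"
  using assms(2)
  by induction (auto intro: rtranclp.rtrancl_into_rtrancl pair_step_swap[OF assms(1)])

text \<open>Only finitely many pairs are reachable, so a single tour visits them all. Its two
  coordinates are the required maps, and the reachability hypotheses make them surjective.\<close>

lemma pair_walk_span_witness:
  assumes K: "symp K"
    and start: "fst s \<in> pverts G" "snd s \<in> pverts G" "m \<le> graph_dist G (fst s) (snd s)"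
    and fst_reach: "\<And>x. x \<in> pverts G \<Longrightarrow> \<exists>y. (pair_step K m G)\<^sup>*\<^sup>* s (x, y)"
    and snd_reach: "\<And>y. y \<in> pverts G \<Longrightarrow> \<exists>x. (pair_step K m G)\<^sup>*\<^sup>* s (x, y)"
  shows "\<exists>P f g. span_witness K m G P f g"
proof -
  let ?R = "pair_step K m G"
  \<comment> \<open>A step constrains the pairs at both its ends, but the empty walk contains no
    step; there \<open>start\<close> is needed.\<close>
  have safe: "fst t \<in> pverts G \<and> snd t \<in> pverts G \<and> m \<le> graph_dist G (fst t) (snd t)"
    if "?R\<^sup>*\<^sup>* s t" for t
    using that start by induction (auto simp: pair_step_def)
  let ?X = "{t. ?R\<^sup>*\<^sup>* s t}"
  have "?X \<subseteq> pverts G \<times> pverts G" using safe by fastforce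
  then have "finite ?X" using finite_subset pair_finite_verts by blast
  then obtain xs where xs: "xs \<noteq> []" "hd xs = s" "successively ?R xs" "?X \<subseteq> set xs"
    using symp_rtranclp_tour[OF _ symp_pair_step[OF K], of ?X m s] by blast
  have step: "?R (xs ! i) (xs ! Suc i)" if "Suc i < length xs" for i
    using xs(3) that by (simp add: successively_conv_nth)
  have reach: "?R\<^sup>*\<^sup>* s (xs ! i)" if "i < length xs" for i
    using that
  proof (induction i)
    case 0
    then show ?case using xs(1,2) by (simp add: hd_conv_nth)
  next
    case (Suc i)
    then show ?case using step[of i] by (meson Suc_lessD rtranclp.rtrancl_into_rtrancl)
  qed
  have set_xs: "set xs = ?X"
    using xs(4) reach by (metis (no_types, lifting) in_set_conv_nth mem_Collect_eq subsetI subset_antisym)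
  let ?ns = "[0..<length xs]"
  \<comment> \<open>The vertices are the positions in the tour, not the visited pairs, since the
    tour may repeat pairs.\<close>
  define P :: "nat pair_pre_digraph" where
    "P = \<lparr>pverts = set ?ns, parcs = set (vwalk_arcs ?ns) \<union> (set (vwalk_arcs ?ns))\<inverse>\<rparr>"
  define f g where "f = (\<lambda>i. fst (xs ! i))" and "g = (\<lambda>i. snd (xs ! i))"
  have path: "path_graph P"
    unfolding path_graph_def P_def using xs(1) by (intro exI[of _ ?ns]) simp
  have arc: "?R (f u, g u) (f v, g v)" if "(u, v) \<in> parcs P" for u v
  proof -
    \<comment> \<open>Each edge of the path yields both arcs, so the backward one needs the symmetry
      of the steps.\<close>
    have "?R (xs ! u) (xs ! v)"
      using that step sympD[OF symp_pair_step[OF K] step]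
      by (auto simp: P_def set_vwalk_arcs_upt)
    then show ?thesis by (simp add: f_def g_def)
  qed
  have "(\<lambda>i. xs ! i) ` pverts P = ?X"
    unfolding set_xs[symmetric] P_def by (simp add: nth_image)
  then have im: "f ` pverts P = fst ` ?X" "g ` pverts P = snd ` ?X"
    unfolding f_def g_def image_image[symmetric, of _ "\<lambda>i. xs ! i"] by simp_all
  have "fst ` ?X = pverts G"
  proof
    show "pverts G \<subseteq> fst ` ?X"
    proof
      fix x assume "x \<in> pverts G"
      then obtain y where "(x, y) \<in> ?X" using fst_reach by blast
      then show "x \<in> fst ` ?X" by (rule image_eqI[rotated]) simp
    qed
  qed (use safe in blast)
  moreover have "snd ` ?X = pverts G"
  proof
    show "pverts G \<subseteq> snd ` ?X"
    proof
      fix y assume "y \<in> pverts G"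
      then obtain x where "(x, y) \<in> ?X" using snd_reach by blast
      then show "y \<in> snd ` ?X" by (rule image_eqI[rotated]) simp
    qed
  qed (use safe in blast)
  ultimately have surj: "f ` pverts P = pverts G" "g ` pverts P = pverts G" using im by simp_all
  have dist: "m \<le> graph_dist G (f u) (g u)" if "u \<in> pverts P" for u
    using that safe reach by (auto simp: P_def f_def g_def)
  have "{graph_dist G (f u) (g u) | u. u \<in> pverts P} = (\<lambda>u. graph_dist G (f u) (g u)) ` pverts P"
    by blast
  then have "m \<le> min_dist P G f g"
    unfolding min_dist_def using finite_pverts_path_graph[OF path] dist by auto
  moreover have "surj_weak_hom P G f" "surj_weak_hom P G g"
    using arc surj by (auto simp: surj_weak_hom_def weak_hom_def pair_step_def)
  moreover have "\<forall>(u, v) \<in> parcs P. K ((f u, f v) \<in> parcs G) ((g u, g v) \<in> parcs G)"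
    using arc by (auto simp: pair_step_def)
  ultimately have "span_witness K m G P f g"
    using path by (simp add: span_witness_def)
  then show ?thesis by blast
qed

text \<open>The first walker roams freely while the second one stays in \<open>W\<close>; by symmetry the roles can be
  exchanged, since the starting positions are both in \<open>W\<close>.\<close>

lemma evasion_span_witness:
  assumes conn: "connected (with_proj G)"
    and K: "symp K"
    and W: "W \<subseteq> pverts G"
    and mn: "m \<le> n"
    and start: "a\<^sub>0 \<in> W" "b\<^sub>0 \<in> W" "n \<le> graph_dist G a\<^sub>0 b\<^sub>0"
    and evade: "\<And>a a' b. (a, a') \<in> parcs G \<Longrightarrow> b \<in> W \<Longrightarrow> n \<le> graph_dist G a b \<Longrightarrow>
      \<exists>b' \<in> W. n \<le> graph_dist G a' b' \<and> (pair_step K m G)\<^sup>*\<^sup>* (a, b) (a', b')"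
  shows "\<exists>P f g. span_witness K m G P f g"
proof -
  \<comment> \<open>The bound \<open>n\<close> is restored after each answered move of the first
    walker; within an answer only \<open>m\<close> is guaranteed.\<close>
  have roam: "\<exists>b' \<in> W. n \<le> graph_dist G x b' \<and> (pair_step K m G)\<^sup>*\<^sup>* (a, b) (x, b')"
    if "awalk a p x" "b \<in> W" "n \<le> graph_dist G a b" for a b p x
    using that
  proof (induction p arbitrary: a b)
    case Nil
    then show ?case by (auto simp: awalk_Nil_iff)
  next
    case (Cons e p)
    then have "(a, snd e) \<in> parcs G" "awalk (snd e) p x"
      by (auto simp: awalk_Cons_iff)
    with Cons show ?case
      using evade by (meson rtranclp_trans)
  qed
  have reach: "\<exists>b'. (pair_step K m G)\<^sup>*\<^sup>* (a, b) (x, b')"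
    if "a \<in> W" "b \<in> W" "n \<le> graph_dist G a b" "x \<in> pverts G" for a b x
  proof -
    have "a \<in> pverts G" using that(1) W by blast
    with conn that(4) obtain p where "apath a p x" by (blast elim: shortest_apath)
    then have "awalk a p x" by (rule awalkI_apath)
    with roam that(2,3) show ?thesis by blast
  qed
  show ?thesis
  proof (rule pair_walk_span_witness[OF K, of "(a\<^sub>0, b\<^sub>0)"])
    show "fst (a\<^sub>0, b\<^sub>0) \<in> pverts G" "snd (a\<^sub>0, b\<^sub>0) \<in> pverts G" using start W by auto
    show "m \<le> graph_dist G (fst (a\<^sub>0, b\<^sub>0)) (snd (a\<^sub>0, b\<^sub>0))" using start mn by simp
    show "\<exists>y. (pair_step K m G)\<^sup>*\<^sup>* (a\<^sub>0, b\<^sub>0) (x, y)" if "x \<in> pverts G" for x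
      using reach start that by blast
    show "\<exists>x. (pair_step K m G)\<^sup>*\<^sup>* (a\<^sub>0, b\<^sub>0) (x, y)" if "y \<in> pverts G" for y
    proof -
      \<comment> \<open>A walk in which the second walker roams is the swapped image of one from
        \<open>(b\<^sub>0, a\<^sub>0)\<close>.\<close>
      have "n \<le> graph_dist G b\<^sub>0 a\<^sub>0" using start(3) by (simp add: graph_dist_commute)
      with reach start(1,2) that obtain b' where "(pair_step K m G)\<^sup>*\<^sup>* (b\<^sub>0, a\<^sub>0) (y, b')"
        by blast
      from pair_steps_swap[OF K this] show ?thesis by auto
    qed
  qed
qed

section \<open>Evasion strategies on a fixed cycle\<close>

context
  fixes c
  assumes conn: "connected (with_proj G)" and c: "graph_cycle G c"
begin

lemma cycle_subset_pverts: "snd ` set c \<subseteq> pverts G"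
proof -
  have "set c \<subseteq> parcs G"
    using c by (auto simp: graph_cycle_def cycle_def)
  then show ?thesis using arc_snd_in_verts by blast
qed

lemma cycle_farther_neighbour:
  assumes "a \<in> pverts G" "b \<in> snd ` set c" "graph_dist G a b < girth G div 2"
  obtains b' where "b' \<in> snd ` set c" "(b, b') \<in> parcs G" "graph_dist G a b < graph_dist G a b'"
proof -
  obtain x y where "x \<in> snd ` set c" "y \<in> snd ` set c" "x \<noteq> y" "(b, x) \<in> parcs G" "(b, y) \<in> parcs G"
    using cycle_two_neighbours[OF c assms(2)] by blast
  with one_of_two_neighbours_farther[OF conn assms(1)] assms(3) that show ?thesis
    by metis
qed

text \<open>This is the answer of a walker who may not rest: below half the girth some move gains at
  least one, and from half the girth on every move loses at most one.\<close>

lemma cycle_neighbour_ge: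
  assumes "a \<in> pverts G" "b \<in> snd ` set c" "girth G div 2 \<le> graph_dist G a b + 2"
  obtains b' where "b' \<in> snd ` set c" "(b, b') \<in> parcs G" "girth G div 2 \<le> graph_dist G a b' + 1"
proof (cases "graph_dist G a b < girth G div 2")
  case True
  then obtain b' where "b' \<in> snd ` set c" "(b, b') \<in> parcs G" "graph_dist G a b < graph_dist G a b'"
    using cycle_farther_neighbour[OF assms(1,2)] by blast
  then show ?thesis using that assms(3) by auto
next
  case False
  obtain b' where b': "b' \<in> snd ` set c" "(b, b') \<in> parcs G"
    using cycle_two_neighbours[OF c assms(2)] by blast
  then have "graph_dist G b a \<le> Suc (graph_dist G b' a)"
    by (intro graph_dist_step[OF conn _ assms(1)])
  then show ?thesis
    using that[OF b'] False by (simp add: graph_dist_commute[of a])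
qed

text \<open>A cycle vertex farthest from \<open>a\<close> works: were it closer than half the girth,
  one of its cycle neighbours would be farther still.\<close>

lemma cycle_far_pair:
  obtains a b where "a \<in> snd ` set c" "b \<in> snd ` set c" "girth G div 2 \<le> graph_dist G a b"
proof -
  have "c \<noteq> []" using c by (auto simp: graph_cycle_def)
  then obtain a where a: "a \<in> snd ` set c" by (cases c) auto
  let ?D = "graph_dist G a ` snd ` set c"
  have "Max ?D \<in> ?D" using a by (intro Max_in) auto
  then obtain b where b: "b \<in> snd ` set c" "graph_dist G a b = Max ?D" by (metis imageE)
  have "\<not> graph_dist G a b < girth G div 2"
  proof
    assume "graph_dist G a b < girth G div 2"
    moreover have "a \<in> pverts G" using a cycle_subset_pverts by blast
    ultimately obtain b' where "b' \<in> snd ` set c" "graph_dist G a b < graph_dist G a b'"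
      using cycle_farther_neighbour b(1) by blast
    moreover from this have "graph_dist G a b' \<le> Max ?D" by (intro Max_ge) auto
    ultimately show False using b(2) by simp
  qed
  then show ?thesis using that[OF a b(1)] by simp
qed

lemma strong_witness: "\<exists>P f g. span_witness (\<lambda>_ _. True) (girth G div 2) G P f g"
proof -
  obtain a\<^sub>0 b\<^sub>0 where start: "a\<^sub>0 \<in> snd ` set c" "b\<^sub>0 \<in> snd ` set c" "girth G div 2 \<le> graph_dist G a\<^sub>0 b\<^sub>0"
    by (rule cycle_far_pair)
  show ?thesis
  proof (rule evasion_span_witness[OF conn _ cycle_subset_pverts order_refl start])
    fix a a' b
    assume a: "(a, a') \<in> parcs G" and b: "b \<in> snd ` set c" and d: "girth G div 2 \<le> graph_dist G a b"
    have verts: "a \<in> pverts G" "a' \<in> pverts G" "b \<in> pverts G"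
      using a b cycle_subset_pverts in_arcsD1 in_arcsD2 by blast+
    have dist: "graph_dist G a b \<le> Suc (graph_dist G a' b)"
      using conn a verts(3) by (rule graph_dist_step)
    \<comment> \<open>The first walker's move costs at most one. If that breaks the bound, one
      evading step, made simultaneously, restores it; otherwise the second walker rests.\<close>
    obtain b' where b': "b' \<in> snd ` set c" "(b, b') \<in> parcs G \<or> b = b'" "girth G div 2 \<le> graph_dist G a' b'"
    proof (cases "graph_dist G a' b < girth G div 2")
      case True
      then obtain b' where "b' \<in> snd ` set c" "(b, b') \<in> parcs G" "graph_dist G a' b < graph_dist G a' b'"
        using cycle_farther_neighbour verts(2) b by blast
      then show ?thesis using that dist d by force
    next
      case False
      then show ?thesis using that b by auto
    qed
    then have "pair_step (\<lambda>_ _. True) (girth G div 2) G (a, b) (a', b')"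
      using a verts d cycle_subset_pverts by (auto simp: pair_step_def)
    then show "\<exists>b' \<in> snd ` set c. girth G div 2 \<le> graph_dist G a' b' \<and>
        (pair_step (\<lambda>_ _. True) (girth G div 2) G)\<^sup>*\<^sup>* (a, b) (a', b')"
      using b' by blast
  qed (simp add: symp_def)
qed

lemma direct_witness: "\<exists>P f g. span_witness (=) (girth G div 2 - 1) G P f g"
proof -
  obtain a\<^sub>0 b\<^sub>0 where start: "a\<^sub>0 \<in> snd ` set c" "b\<^sub>0 \<in> snd ` set c" "girth G div 2 \<le> graph_dist G a\<^sub>0 b\<^sub>0"
    by (rule cycle_far_pair)
  then have "girth G div 2 - 1 \<le> graph_dist G a\<^sub>0 b\<^sub>0" by simp
  note start = start(1,2) this
  show ?thesis
  proof (rule evasion_span_witness[OF conn _ cycle_subset_pverts order_refl start])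
    fix a a' b
    assume a: "(a, a') \<in> parcs G" and b: "b \<in> snd ` set c"
      and d: "girth G div 2 - 1 \<le> graph_dist G a b"
    have verts: "a \<in> pverts G" "a' \<in> pverts G" "b \<in> pverts G"
      using a b cycle_subset_pverts in_arcsD1 in_arcsD2 by blast+
    have "graph_dist G a b \<le> Suc (graph_dist G a' b)"
      using conn a verts(3) by (rule graph_dist_step)
    \<comment> \<open>One unit is already missing in the invariant and one more is lost by the first
      walker's move; the forced answer recovers enough.\<close>
    with d have "girth G div 2 \<le> graph_dist G a' b + 2" by linarith
    then obtain b' where b': "b' \<in> snd ` set c" "(b, b') \<in> parcs G"
      "girth G div 2 \<le> graph_dist G a' b' + 1"
      using cycle_neighbour_ge verts(2) b by blast
    then have "pair_step (=) (girth G div 2 - 1) G (a, b) (a', b')"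
      using a verts d cycle_subset_pverts by (auto simp: pair_step_def)
    then show "\<exists>b' \<in> snd ` set c. girth G div 2 - 1 \<le> graph_dist G a' b' \<and>
        (pair_step (=) (girth G div 2 - 1) G)\<^sup>*\<^sup>* (a, b) (a', b')"
      using b' by (intro bexI[of _ b']) auto
  qed (simp add: symp_def)
qed

text \<open>A move of both walkers is split into two; in between the distance drops by at most one.\<close>

lemma cartesian_witness: "\<exists>P f g. span_witness (\<noteq>) (girth G div 2 - 1) G P f g"
proof -
  obtain a\<^sub>0 b\<^sub>0 where start: "a\<^sub>0 \<in> snd ` set c" "b\<^sub>0 \<in> snd ` set c" "girth G div 2 \<le> graph_dist G a\<^sub>0 b\<^sub>0"
    by (rule cycle_far_pair)
  show ?thesis
  \<comment> \<open>Here \<open>n\<close> is half the girth and \<open>m\<close> is one less, which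
    allows for the intermediate position where only the first walker has moved.\<close>
  proof (rule evasion_span_witness[OF conn _ cycle_subset_pverts diff_le_self start])
    fix a a' b
    assume a: "(a, a') \<in> parcs G" and b: "b \<in> snd ` set c" and d: "girth G div 2 \<le> graph_dist G a b"
    let ?R = "pair_step (\<noteq>) (girth G div 2 - 1) G"
    have loop: "(x, x) \<notin> parcs G" for x using no_loops' by blast
    have verts: "a \<in> pverts G" "a' \<in> pverts G" "b \<in> pverts G"
      using a b cycle_subset_pverts in_arcsD1 in_arcsD2 by blast+
    have dist: "graph_dist G a b \<le> Suc (graph_dist G a' b)"
      using conn a verts(3) by (rule graph_dist_step)
    \<comment> \<open>Loop-freeness makes resting differ from moving along an edge, as
      \<open>K\<close> demands.\<close>
    then have 1: "?R (a, b) (a', b)"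
      using a verts d loop by (auto simp: pair_step_def)
    show "\<exists>b' \<in> snd ` set c. girth G div 2 \<le> graph_dist G a' b' \<and> ?R\<^sup>*\<^sup>* (a, b) (a', b')"
    proof (cases "graph_dist G a' b < girth G div 2")
      case True
      then obtain b' where b': "b' \<in> snd ` set c" "(b, b') \<in> parcs G" "graph_dist G a' b < graph_dist G a' b'"
        using cycle_farther_neighbour verts(2) b by blast
      then have "?R (a', b) (a', b')"
        using verts d dist loop cycle_subset_pverts by (auto simp: pair_step_def)
      with 1 have "?R\<^sup>*\<^sup>* (a, b) (a', b')" by auto
      moreover have "girth G div 2 \<le> graph_dist G a' b'" using d dist b'(3) by linarith
      ultimately show ?thesis using b'(1) by blast
    next
      case False
      then show ?thesis using 1 b by (intro bexI[of _ b]) auto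
    qed
  qed (auto simp: symp_def)
qed

end

end

section \<open>From witnesses to the three spans\<close>

theorem theorem2p2:
  fixes G :: "'a pair_pre_digraph"
  assumes "pair_graph G"
    and "connected (with_proj G)"
    and "\<exists>c. graph_cycle G c"
  shows "int (strong_vertex_span G) \<ge> \<lfloor>real (girth G) / 2\<rfloor>
    \<and> int (cartesian_vertex_span G) \<ge> \<lfloor>real (girth G) / 2\<rfloor> - 1
    \<and> int (direct_vertex_span G) \<ge> \<lfloor>real (girth G) / 2\<rfloor> - 1"
proof -
  interpret pair_graph G by fact
  obtain c where c: "graph_cycle G c" using assms(3) by blast
  let ?k = "girth G div 2"
  obtain P f g where w: "span_witness (\<lambda>_ _. True) ?k G P f g"
    using strong_witness[OF assms(2) c] by blast
  have strong: "?k \<le> strong_vertex_span G"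
    unfolding strong_vertex_span_def
  proof (rule Max_min_dist_ge[OF pair_finite_verts])
    show "path_graph P \<and> surj_weak_hom P G f \<and> surj_weak_hom P G g"
      "?k \<le> min_dist P G f g"
      using w by (simp_all add: span_witness_def)
  qed simp
  obtain P f g where w: "span_witness (\<noteq>) (?k - 1) G P f g"
    using cartesian_witness[OF assms(2) c] by blast
  have opp: "opposite P G f g"
    unfolding opposite_def
  proof (intro ballI, clarify)
    fix u v assume uv: "(u, v) \<in> parcs P"
    \<comment> \<open>The witness only separates edges from non-edges; a non-edge becomes an
      equality because \<open>g\<close> is a weak homomorphism and \<open>G\<close> has no
      loops.\<close>
    have "((f u, f v) \<in> parcs G) \<noteq> ((g u, g v) \<in> parcs G)"
      using w uv by (auto simp: span_witness_def)
    moreover have "(g u, g v) \<in> parcs G \<or> g u = g v"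
      using w uv by (auto simp: span_witness_def surj_weak_hom_def weak_hom_def)
    moreover have "(g u, g v) \<in> parcs G \<Longrightarrow> g u \<noteq> g v" by (rule no_loops')
    ultimately show "(f u, f v) \<in> parcs G \<longleftrightarrow> g u = g v" by blast
  qed
  have cart: "?k - 1 \<le> cartesian_vertex_span G"
    unfolding cartesian_vertex_span_def
  proof (rule Max_min_dist_ge[OF pair_finite_verts])
    show "path_graph P \<and> surj_weak_hom P G f \<and> surj_weak_hom P G g \<and> opposite P G f g"
      "?k - 1 \<le> min_dist P G f g"
      using w opp by (simp_all add: span_witness_def)
  qed simp
  obtain P f g where w: "span_witness (=) (?k - 1) G P f g"
    using direct_witness[OF assms(2) c] by blast
  then have al: "aligned P G f g"
    by (auto simp: aligned_def span_witness_def)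
  have direct: "?k - 1 \<le> direct_vertex_span G"
    unfolding direct_vertex_span_def
  proof (rule Max_min_dist_ge[OF pair_finite_verts])
    show "path_graph P \<and> surj_weak_hom P G f \<and> surj_weak_hom P G g \<and> aligned P G f g"
      "?k - 1 \<le> min_dist P G f g"
      using w al by (simp_all add: span_witness_def)
  qed simp
  \<comment> \<open>The truncated difference \<open>?k - 1\<close> is at least the integer one, so
    the bounds carry over to integers.\<close>
  have "\<lfloor>real (girth G) / 2\<rfloor> = int ?k"
    using floor_divide_of_nat_eq[of "girth G" 2] by simp
  with strong cart direct show ?thesis by linarith
qed

end
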